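(* Let $0<q<1$, $n\ge1$ and $m\ge n$, and put $s=s^{\rm sym}_{m|n}=\frac1nq^{2m-2n}[2n]_q$ where $[r]_q=\frac{1-q^r}{1-q}$. Then $0<s<2$. On the standard polynomial oscillator $\mathbb C[u]$ with $a=\partial_u$, $b=-2iu$, so that $B_{\rm f}u^r=-i(2r+1)u^r$, every shifted $q$-dependent Cartan factor is nonzero: for all $k\in\mathbb Z$ and $r\in\mathbb N$ (including $r=0$), $$(\sigma^k\ell_+)(B_{\rm f})u^r=\big(s-2+4(k-r)\big)u^r\ne0,\qquad(\sigma^k\ell_-)(B_{\rm f})u^r=\big(s+2+4(r-k)\big)u^r\ne0.$$ The shifted Weyl factor satisfies $(\sigma^kd)(B_{\rm f})u^r=-2i(r+1-k)u^r$, so any residual all-charge oscillator resonance (a vanishing shifted factor) belongs only to this $q$-independent orbit. In particular, for $N\ge1$ and $m\ge\max\{2N,n\}$, the $q$-dependent part of the localization (the factors $\sigma^k\ell_\pm$) is nonresonant on every polynomial degree.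
   Context: $a,b$ satisfy $ab-ba=-2i$ and $B_{\rm f}=ba-i$. The shift is $\sigma R(B)=R(B+2i)$, and $d(B)=B-i$, $\ell_+(B)=s-2iB$, $\ell_-(B)=s+2iB$. The Cartan localization used for the fermionic coefficient ring inverts all $\sigma^kd,\sigma^k\ell_+,\sigma^k\ell_-$, $k\in\mathbb Z$; the $q$-dependent part consists of the factors $\sigma^k\ell_\pm$, which depend on $q$ through $s$. $N$ is the number of bosonic vector labels, and $m\ge2N$ is the stable range. *)

theory Defs
  imports Complex_Main "HOL-Computational_Algebra.Polynomial"
begin

definition q_int :: "real \<Rightarrow> nat \<Rightarrow> real" where
  "q_int q r = (1 - q ^ r) / (1 - q)"

text \<open>The parameter s^sym_{m|n}. The exponent uses subtraction of naturals, so it is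
  meaningful only for \<open>n \<le> m\<close>.\<close>
definition s_sym :: "real \<Rightarrow> nat \<Rightarrow> nat \<Rightarrow> real" where
  "s_sym q m n = 1 / real n * q ^ (2 * m - 2 * n) * q_int q (2 * n)"

text \<open>Elements of the Cartan coefficient ring are polynomials in the formal variable \<open>B\<close>.\<close>

definition shift :: "complex poly \<Rightarrow> complex poly" where
  "shift R = R \<circ>\<^sub>p [:2 * \<i>, 1:]"

lemma shift_inverse:
  "shift (R \<circ>\<^sub>p [:- 2 * \<i>, 1:]) = R" "shift R \<circ>\<^sub>p [:- 2 * \<i>, 1:] = R"
  by (simp_all add: shift_def pcompose_assoc [symmetric] pcompose_pCons)

lemma bij_shift: "bij shift"
  by (rule o_bij [where g = "\<lambda>R. R \<circ>\<^sub>p [:- 2 * \<i>, 1:]"])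
     (simp_all only: fun_eq_iff o_apply id_apply shift_inverse simp_thms)

definition shift_pow :: "int \<Rightarrow> complex poly \<Rightarrow> complex poly" where
  "shift_pow k = (if k \<ge> 0 then shift ^^ nat k else inv shift ^^ nat (- k))"

definition d_fac :: "complex poly" where
  "d_fac = [:- \<i>, 1:]"

definition l_plus :: "real \<Rightarrow> complex poly" where
  "l_plus s = [:of_real s, - 2 * \<i>:]"

definition l_minus :: "real \<Rightarrow> complex poly" where
  "l_minus s = [:of_real s, 2 * \<i>:]"

definition weyl_orbit :: "complex poly set" where
  "weyl_orbit = range (\<lambda>k. shift_pow k d_fac)"

definition q_dependent_factors :: "real \<Rightarrow> complex poly set" where
  "q_dependent_factors s =
     range (\<lambda>k. shift_pow k (l_plus s)) \<union> range (\<lambda>k. shift_pow k (l_minus s))"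

text \<open>The elements inverted by the Cartan localization.\<close>
definition cartan_factors :: "real \<Rightarrow> complex poly set" where
  "cartan_factors s = weyl_orbit \<union> q_dependent_factors s"

text \<open>The oscillator module \<open>\<complex>[u]\<close> is also a type of polynomials, now in the variable \<open>u\<close>.\<close>

definition osc_a :: "complex poly \<Rightarrow> complex poly" where
  "osc_a p = pderiv p"

definition osc_b :: "complex poly \<Rightarrow> complex poly" where
  "osc_b p = smult (- 2 * \<i>) (monom 1 1 * p)"

definition B_f :: "complex poly \<Rightarrow> complex poly" where
  "B_f p = osc_b (osc_a p) - smult \<i> p"

lemma osc_commutator: "osc_a (osc_b p) - osc_b (osc_a p) = smult (- 2 * \<i>) p"
proof -
  have "osc_a (osc_b p) = smult (- 2 * \<i>) (monom 1 1 * pderiv p + p)"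
    by (simp add: osc_a_def osc_b_def pderiv_smult pderiv_mult pderiv_monom monom_0
        del: smult_minus_left)
  then show ?thesis
    by (simp add: osc_a_def osc_b_def smult_add_right)
qed

text \<open>The value \<open>R(T)\<close> of a polynomial at a linear operator on \<open>\<complex>[u]\<close>.\<close>
definition op_eval :: "complex poly \<Rightarrow> (complex poly \<Rightarrow> complex poly) \<Rightarrow> complex poly \<Rightarrow> complex poly"
  where "op_eval R T p = (\<Sum>j\<le>degree R. smult (coeff R j) ((T ^^ j) p))"

abbreviation u_pow :: "nat \<Rightarrow> complex poly" where
  "u_pow r \<equiv> monom 1 r"

definition resonant :: "complex poly \<Rightarrow> bool" where
  "resonant R \<longleftrightarrow> (\<exists>r. op_eval R B_f (u_pow r) = 0)"

end

theory Submission
  imports Defs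
begin

text \<open>The monomials \<open>u\<^sup>r\<close> are eigenvectors of \<open>B\<^sub>f\<close>, so a polynomial in \<open>B\<^sub>f\<close> acts on them by its
  value at \<open>-\<i>(2r + 1)\<close>. The shifted factors are affine, and resonance of a factor
  \<open>\<sigma>\<^sup>k\<ell>\<^sub>\<plusminus>\<close> would force \<open>s\<close> to be congruent to 2 modulo 4. This is impossible: \<open>n s\<close> is a power
  of \<open>q\<close> times the geometric sum of length \<open>2n\<close>, whence \<open>0 < s < 2\<close>.\<close>

text \<open>Iterates started at an eigenvector stay on the line spanned by \<open>p\<close>, so
  compatibility of \<open>T\<close> with scalars is enough.\<close>

lemma funpow_eigenvector:
  fixes T :: "'a::comm_semiring_1 poly \<Rightarrow> 'a poly"
  assumes "\<And>a x. T (smult a x) = smult a (T x)" and "T p = smult c p"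
  shows "(T ^^ j) p = smult (c ^ j) p"
  by (induction j) (simp_all add: assms mult.commute)

lemma op_eval_eigenvector:
  assumes "\<And>a x. T (smult a x) = smult a (T x)" and "T p = smult c p"
  shows "op_eval R T p = smult (poly R c) p"
  unfolding op_eval_def funpow_eigenvector [OF assms]
  by (simp add: poly_altdef smult_sum)

lemma B_f_smult: "B_f (smult c p) = smult c (B_f p)"
  by (simp add: B_f_def osc_a_def osc_b_def pderiv_smult smult_diff_right mult.commute)

lemma B_f_u_pow: "B_f (u_pow r) = smult (- \<i> * (2 * of_nat r + 1)) (u_pow r)"
\<comment> \<open>The derivative of u^r involves the truncated exponent r - 1; multiplying by u
  restores u^r only for r > 0, while at r = 0 the derivative vanishes.\<close>
proof (cases r)
  case 0
  then show ?thesis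
    by (simp add: B_f_def osc_a_def osc_b_def pderiv_monom smult_monom)
next
  case (Suc r')
  then show ?thesis
    by (simp add: B_f_def osc_a_def osc_b_def pderiv_monom smult_monom mult_monom minus_monom
        diff_monom algebra_simps)
qed

lemma op_eval_B_f_u_pow:
  "op_eval R B_f (u_pow r) = smult (poly R (- \<i> * (2 * of_nat r + 1))) (u_pow r)"
  by (rule op_eval_eigenvector [OF B_f_smult B_f_u_pow])

lemma inv_shift: "inv shift R = R \<circ>\<^sub>p [:- 2 * \<i>, 1:]"
  using shift_inverse(1) by (rule inv_f_eq [OF bij_is_inj [OF bij_shift]])

lemma poly_shift_funpow: "poly ((shift ^^ j) R) x = poly R (x + 2 * \<i> * of_nat j)"
  by (induction j arbitrary: x) (simp_all add: shift_def poly_pcompose algebra_simps)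

lemma poly_inv_shift_funpow: "poly ((inv shift ^^ j) R) x = poly R (x - 2 * \<i> * of_nat j)"
  by (induction j arbitrary: x) (simp_all add: inv_shift poly_pcompose algebra_simps)

text \<open>Both branches of \<open>shift_pow\<close> translate the argument, by opposite signs of
  2i, so one formula covers all integers \<open>k\<close>.\<close>

lemma poly_shift_pow: "poly (shift_pow k R) x = poly R (x + 2 * \<i> * of_int k)"
proof (cases "k \<ge> 0")
  case True
  then show ?thesis
    by (simp add: shift_pow_def poly_shift_funpow)
next
  case False
  then show ?thesis
    by (simp add: shift_pow_def poly_inv_shift_funpow)
qed

lemma op_eval_shift_pow_l_plus:
  "op_eval (shift_pow k (l_plus s)) B_f (u_pow r)
     = smult (of_real s - 2 + 4 * (of_int k - of_nat r)) (u_pow r)"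
  by (simp add: op_eval_B_f_u_pow poly_shift_pow l_plus_def algebra_simps)

lemma op_eval_shift_pow_l_minus:
  "op_eval (shift_pow k (l_minus s)) B_f (u_pow r)
     = smult (of_real s + 2 + 4 * (of_nat r - of_int k)) (u_pow r)"
  by (simp add: op_eval_B_f_u_pow poly_shift_pow l_minus_def algebra_simps)

lemma op_eval_shift_pow_d_fac:
  "op_eval (shift_pow k d_fac) B_f (u_pow r)
     = smult (- 2 * \<i> * (of_nat r + 1 - of_int k)) (u_pow r)"
  by (simp add: op_eval_B_f_u_pow poly_shift_pow d_fac_def algebra_simps)

lemma q_int_eq_sum:
  assumes "q \<noteq> 1"
  shows "q_int q r = (\<Sum>i<r. q ^ i)"
  using assms by (simp add: q_int_def sum_gp_strict)

lemma q_int_pos: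
  assumes "0 < q" and "q < 1" and "r \<ge> 1"
  shows "0 < q_int q r"
  using assms by (simp add: q_int_def power_less_one_iff)

lemma q_int_less:
  assumes "0 < q" and "q < 1" and "r \<ge> 2"
  shows "q_int q r < real r"
proof -
  have "(\<Sum>i<r. q ^ i) < (\<Sum>i<r. 1)"
  proof (rule sum_strict_mono_ex1)
    show "\<forall>i\<in>{..<r}. q ^ i \<le> 1"
      using assms by (simp add: power_le_one)
    \<comment> \<open>The term at index 0 equals 1, so strictness first occurs at index 1, which is
      in range because \<open>r \<ge> 2\<close>.\<close>
    show "\<exists>i\<in>{..<r}. q ^ i < 1"
      using assms by (intro bexI [of _ 1]) auto
  qed simp
  then show ?thesis
    using assms by (simp add: q_int_eq_sum)
qed

lemma s_sym_pos:
  assumes "0 < q" and "q < 1" and "n \<ge> 1"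
  shows "0 < s_sym q m n"
  using assms by (simp add: s_sym_def q_int_pos)

lemma s_sym_less_two:
  assumes "0 < q" and "q < 1" and "n \<ge> 1"
  shows "s_sym q m n < 2"
proof -
  \<comment> \<open>The power of q lies in (0, 1], so dropping it can only enlarge the
    product.\<close>
  have "q ^ (2 * m - 2 * n) * q_int q (2 * n) \<le> q_int q (2 * n)"
    using assms q_int_pos [of q "2 * n"]
    by (intro mult_left_le_one_le) (simp_all add: power_le_one)
  also have "\<dots> < 2 * real n"
    using assms q_int_less [of q "2 * n"] by simp
  finally show ?thesis
    using assms by (simp add: s_sym_def field_simps)
qed

lemma add_multiple_of_four_nonzero:
  fixes s :: real and j :: int
  assumes "0 < s" and "s < 2"
  shows "complex_of_real s - 2 + 4 * of_int j \<noteq> 0"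
proof
  assume "complex_of_real s - 2 + 4 * of_int j = 0"
  then have "complex_of_real (s - 2 + 4 * of_int j) = 0"
    by simp
  then have "s - 2 + 4 * of_int j = 0"
    by (simp only: of_real_eq_0_iff)
  \<comment> \<open>Here 4j = 2 - s lies strictly between 0 and 2, which leaves no integer
    j.\<close>
  with assms have "(0::real) < of_int j" and "of_int j < (1::real)"
    by simp_all
  then show False
    by simp
qed

lemma op_eval_shift_pow_l_plus_nonzero:
  assumes "0 < s" and "s < 2"
  shows "op_eval (shift_pow k (l_plus s)) B_f (u_pow r) \<noteq> 0"
  using add_multiple_of_four_nonzero [OF assms, of "k - int r"]
  by (simp add: op_eval_shift_pow_l_plus)

lemma op_eval_shift_pow_l_minus_nonzero:
  assumes "0 < s" and "s < 2"
  shows "op_eval (shift_pow k (l_minus s)) B_f (u_pow r) \<noteq> 0"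
  \<comment> \<open>The extra 1 turns s - 2 into s + 2.\<close>
  using add_multiple_of_four_nonzero [OF assms, of "int r - k + 1"]
  by (simp add: op_eval_shift_pow_l_minus algebra_simps)

lemma q_dependent_factors_nonresonant:
  assumes "0 < s" and "s < 2" and "R \<in> q_dependent_factors s"
  shows "\<not> resonant R"
  using assms op_eval_shift_pow_l_plus_nonzero op_eval_shift_pow_l_minus_nonzero
  by (auto simp: q_dependent_factors_def resonant_def)

theorem corollary3p7:
  fixes q s :: real and m n :: nat
  assumes "0 < q" and "q < 1" and "n \<ge> 1" and "m \<ge> n"
    and "s = s_sym q m n"
  shows "0 < s \<and> s < 2
    \<and> (\<forall>r. B_f (u_pow r) = smult (- \<i> * (2 * of_nat r + 1)) (u_pow r))
    \<and> (\<forall>(k::int) (r::nat).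
          op_eval (shift_pow k (l_plus s)) B_f (u_pow r)
            = smult (of_real s - 2 + 4 * (of_int k - of_nat r)) (u_pow r)
        \<and> op_eval (shift_pow k (l_plus s)) B_f (u_pow r) \<noteq> 0
        \<and> op_eval (shift_pow k (l_minus s)) B_f (u_pow r)
            = smult (of_real s + 2 + 4 * (of_nat r - of_int k)) (u_pow r)
        \<and> op_eval (shift_pow k (l_minus s)) B_f (u_pow r) \<noteq> 0
        \<and> op_eval (shift_pow k d_fac) B_f (u_pow r)
            = smult (- 2 * \<i> * (of_nat r + 1 - of_int k)) (u_pow r))
    \<and> (\<forall>R \<in> cartan_factors s. resonant R \<longrightarrow> R \<in> weyl_orbit \<and> R \<notin> q_dependent_factors s)
    \<and> (\<forall>N::nat. N \<ge> 1 \<and> m \<ge> max (2 * N) n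
          \<longrightarrow> (\<forall>R \<in> q_dependent_factors s. \<not> resonant R))"
proof -
  have s: "0 < s" "s < 2"
    using assms s_sym_pos s_sym_less_two by simp_all
  \<comment> \<open>A resonant Cartan factor cannot be \<open>q\<close>-dependent, so it must come
    from the other half of the union, the Weyl orbit.\<close>
  show ?thesis
    using s B_f_u_pow op_eval_shift_pow_l_plus op_eval_shift_pow_l_minus op_eval_shift_pow_d_fac
      op_eval_shift_pow_l_plus_nonzero [OF s] op_eval_shift_pow_l_minus_nonzero [OF s]
      q_dependent_factors_nonresonant [OF s]
    unfolding cartan_factors_def by blast
qed

end
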